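(* $$\prod_{n=1}^{\infty}\begin{pmatrix}\frac{n}{2(2n+1)} & \frac{-3}{2n(2n+1)} & \frac{3}{2n^{3}}\\ 0 & \frac{n}{2(2n+1)} & \frac{3}{2n}\\ 0 & 0 & 1\end{pmatrix}=\begin{pmatrix}0 & 0 & \zeta(4)\\ 0 & 0 & \zeta(2)\\ 0 & 0 & 1\end{pmatrix}.$$
   Context: $\zeta(s)=\sum_{n\geqslant1}n^{-s}$ is the Riemann zeta function. The infinite product $\prod_{n=1}^\infty \mathbf{M}_n$ of square matrices means the entrywise limit as $m\to\infty$ of the ordered products $\mathbf{M}_1\mathbf{M}_2\cdots\mathbf{M}_m$ (factors multiplied from left to right in increasing index). *)

theory Defs
  imports "HOL-Analysis.Analysis"
begin

text \<open>The Riemann zeta function on the half-line \<open>s > 1\<close>, where the Dirichlet series converges;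
  the value for \<open>s \<le> 1\<close> is meaningless.\<close>

definition riemann_zeta :: "real \<Rightarrow> real" where
  "riemann_zeta s = (\<Sum>n. 1 / real (Suc n) powr s)"

text \<open>\<open>M 1 ** M 2 ** \<dots> ** M m\<close>; the value \<open>M 0\<close> is not used.\<close>

primrec matrix_partial_prod :: "(nat \<Rightarrow> real ^ 'n ^ 'n) \<Rightarrow> nat \<Rightarrow> real ^ 'n ^ 'n" where
  "matrix_partial_prod M 0 = mat 1"
| "matrix_partial_prod M (Suc m) = matrix_partial_prod M m ** M (Suc m)"

definition has_matrix_prod :: "(nat \<Rightarrow> real ^ 'n ^ 'n) \<Rightarrow> real ^ 'n ^ 'n \<Rightarrow> bool" where
  "has_matrix_prod M L \<longleftrightarrow>
     (\<forall>i j. (\<lambda>m. matrix_partial_prod M m $ i $ j) \<longlonglongrightarrow> L $ i $ j)"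

end

theory Submission
  imports Defs "HOL-Real_Asymp.Real_Asymp"
begin

text \<open>
  Write \<open>M\<^sub>n\<close> for the factors. The column vectors \<open>v\<^sub>m = (x\<^sub>m, y\<^sub>m, 1)\<close> with
  \<open>y\<^sub>m = (2m+1) \<Sum>\<^sub>k w\<^sub>m(k)\<close> and \<open>x\<^sub>m = (2m+1) \<Sum>\<^sub>k w\<^sub>m(k) u\<^sub>m(k)\<close>, where
  \<open>w\<^sub>m(k) = m!\<^sup>2 / (k(k+1)\<dots>(k+m))\<^sup>2\<close> and
  \<open>u\<^sub>m(k) = \<Sum>\<^sub>j\<^sub>=\<^sub>0\<^sub>.\<^sub>.\<^sub>m (k+j)\<^sup>-\<^sup>2 - \<Sum>\<^sub>j\<^sub>=\<^sub>1\<^sub>.\<^sub>.\<^sub>m j\<^sup>-\<^sup>2\<close>, satisfy \<open>M\<^sub>m\<^sub>+\<^sub>1 v\<^sub>m\<^sub>+\<^sub>1 = v\<^sub>m\<close>, because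
  the corresponding combinations of summands telescope in \<open>k\<close>. As \<open>v\<^sub>0 = (\<zeta>(4), \<zeta>(2), 1)\<close>, it
  follows that \<open>M\<^sub>1 \<cdots> M\<^sub>m v\<^sub>m = (\<zeta>(4), \<zeta>(2), 1)\<close>. The first two columns of the partial product
  decay like \<open>m 4\<^sup>-\<^sup>m\<close> while \<open>v\<^sub>m\<close> grows polynomially, so the last column tends to
  \<open>(\<zeta>(4), \<zeta>(2), 1)\<close>.

  The telescoping relations are the coefficients of \<open>t\<^sup>0\<close> and \<open>t\<^sup>1\<close> of a WZ pair whose first member
  is proportional to \<open>1 / ((k\<^sup>2 - t) \<cdots> ((k+m)\<^sup>2 - t))\<close>.
\<close>

section \<open>Weights and slopes: shifts in k, values at 1, bounds\<close>

primrec wz_weight :: "nat \<Rightarrow> real \<Rightarrow> real" where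
  "wz_weight 0 k = 1 / k\<^sup>2"
| "wz_weight (Suc m) k = wz_weight m k * (real (Suc m) / (k + real (Suc m)))\<^sup>2"

text \<open>Let F(t) be the product of j^2 - t over j = 1..m divided by the product of (k+j)^2 - t
  over j = 0..m. The weight is F(0), and the slope is the logarithmic derivative F'(0)/F(0).\<close>

primrec wz_slope :: "nat \<Rightarrow> real \<Rightarrow> real" where
  "wz_slope 0 k = 1 / k\<^sup>2"
| "wz_slope (Suc m) k = wz_slope m k + 1 / (k + real (Suc m))\<^sup>2 - 1 / (real (Suc m))\<^sup>2"

text \<open>The shift turns k(k+1)...(k+m) into (k+1)...(k+m+1), so only the two end factors
  change.\<close>

lemma wz_weight_shift:
  assumes "k > 0"
  shows "wz_weight m (k + 1) = wz_weight m k * (k / (k + real (Suc m)))\<^sup>2"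
proof (induction m)
  case 0
  then show ?case using assms by (simp add: field_simps)
next
  case (Suc m)
  have "k + real (Suc m) > 0" "k + real (Suc (Suc m)) > 0" using assms by simp_all
  moreover have "k + 1 + real (Suc m) = k + real (Suc (Suc m))" by simp
  ultimately show ?case
    by (simp only: wz_weight.simps Suc.IH) (simp add: power_divide)
qed

lemma wz_slope_shift:
  "wz_slope m (k + 1) = wz_slope m k - 1 / k\<^sup>2 + 1 / (k + real (Suc m))\<^sup>2"
  by (induction m) (simp_all add: algebra_simps)

lemma wz_weight_one: "wz_weight m 1 = 1 / (real (Suc m))\<^sup>2"
  by (induction m) (simp_all add: power_divide)

lemma wz_slope_one: "wz_slope m 1 = 1 / (real (Suc m))\<^sup>2"
  by (induction m) (simp_all add: algebra_simps)

lemma wz_weight_nonneg: "wz_weight m k \<ge> 0"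
  by (induction m) simp_all

lemma wz_weight_le:
  assumes "k > 0"
  shows "wz_weight m k \<le> 1 / k\<^sup>2"
proof (induction m)
  case (Suc m)
  have "(real (Suc m) / (k + real (Suc m)))\<^sup>2 \<le> 1"
    using assms by (intro power_le_one) simp_all
  then have "wz_weight m k * (real (Suc m) / (k + real (Suc m)))\<^sup>2 \<le> wz_weight m k"
    by (intro mult_left_le wz_weight_nonneg)
  with Suc show ?case by simp
qed simp

text \<open>Each recursion step adds a difference of two numbers in [0, 1].\<close>

lemma abs_wz_slope_le:
  assumes "k \<ge> 1"
  shows "\<bar>wz_slope m k\<bar> \<le> real (Suc m)"
proof (induction m)
  case 0
  then show ?case using assms by simp
next
  case (Suc m)
  have bd: "0 \<le> 1 / z\<^sup>2" "1 / z\<^sup>2 \<le> 1" if "z \<ge> 1" for z :: real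
    using that by simp_all
  show ?case
    using Suc bd[of "k + real (Suc m)"] bd[of "real (Suc m)"] assms
    unfolding wz_slope.simps by linarith
qed

section \<open>Telescoping relations in k\<close>

text \<open>Each weight involved is \<open>a\<close> times a square, which leaves a polynomial
  identity in \<open>k\<close> and \<open>n\<close>.\<close>

lemma wz_weight_telescope:
  fixes m :: nat and k :: real
  defines "n \<equiv> real (Suc m)"
  defines "g \<equiv> \<lambda>k. - wz_weight m k * (k + 3 * n / 2 - 1)"
  assumes "k > 0"
  shows "(2 * n - 1) * wz_weight m k - n / 2 * wz_weight (Suc m) k = g (k + 1) - g k"
proof -
  define a where "a = wz_weight m k / (k + n)\<^sup>2"
  have pos: "k + n > 0" using assms by simp
  then have "wz_weight m k = a * (k + n)\<^sup>2" by (simp add: a_def)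
  moreover have "wz_weight (Suc m) k = a * n\<^sup>2"
    by (simp add: a_def n_def power_divide)
  moreover have "wz_weight m (k + 1) = a * k\<^sup>2"
    unfolding wz_weight_shift[OF \<open>k > 0\<close>] a_def n_def by (simp add: power_divide)
  ultimately show ?thesis
    unfolding g_def by (simp add: field_simps power2_eq_square)
qed

text \<open>The multiplier k + 3n/2 - 1 works for all t when the second coefficient is n(n^2 -
  4t)/(2(n^2 - t)) = n/2 - 3t/(2n) + ...; its t^1 part produces the extra weight term.\<close>

lemma wz_slope_telescope:
  fixes m :: nat and k :: real
  defines "n \<equiv> real (Suc m)"
  defines "g \<equiv> \<lambda>k. - wz_weight m k * wz_slope m k * (k + 3 * n / 2 - 1)"
  assumes "k > 0"
  shows "(2 * n - 1) * (wz_weight m k * wz_slope m k)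
      - n / 2 * (wz_weight (Suc m) k * wz_slope (Suc m) k) + 3 / (2 * n) * wz_weight (Suc m) k
    = g (k + 1) - g k"
proof -
  define a where "a = wz_weight m k / (k + n)\<^sup>2"
  define p where "p = 1 / (k + n)\<^sup>2"
  define u where "u = wz_slope m k"
  have pos: "k + n > 0" "n > 0" using assms by simp_all
  have p: "p * (k + n)\<^sup>2 = 1" using pos by (simp add: p_def)
  have w: "wz_weight m k = a * (k + n)\<^sup>2" using pos by (simp add: a_def)
  have w_Suc: "wz_weight (Suc m) k = a * n\<^sup>2"
    by (simp add: a_def n_def power_divide)
  have "wz_weight m (k + 1) = a * k\<^sup>2"
    unfolding wz_weight_shift[OF \<open>k > 0\<close>] a_def n_def by (simp add: power_divide)
  then have wu_shift: "wz_weight m (k + 1) * wz_slope m (k + 1) = a * k\<^sup>2 * (u + p) - a"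
    unfolding wz_slope_shift u_def p_def n_def[symmetric]
    using \<open>k > 0\<close> by (simp add: algebra_simps)
  have wu_Suc: "wz_weight (Suc m) k * wz_slope (Suc m) k = a * n\<^sup>2 * (u + p) - a"
    unfolding w_Suc wz_slope.simps u_def p_def n_def[symmetric]
    using pos by (simp add: algebra_simps)
  have w_coeff: "3 / (2 * n) * wz_weight (Suc m) k = 3 * n / 2 * a"
    using pos unfolding w_Suc by (simp add: power2_eq_square)
  \<comment> \<open>The claim doubled to clear halves: a polynomial identity modulo
    \<open>p * (k + n)\<^sup>2 = 1\<close>.\<close>
  have "2 * ((2 * n - 1) * (a * (k + n)\<^sup>2 * u)) - n * (a * n\<^sup>2 * (u + p) - a) + 3 * n * a
    = - (a * k\<^sup>2 * (u + p) - a) * (2 * k + 3 * n) + a * (k + n)\<^sup>2 * u * (2 * k + 3 * n - 2)"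
    using p by algebra
  then show ?thesis
    unfolding g_def minus_mult_left[symmetric] wu_shift wu_Suc w_coeff w u_def[symmetric]
    by (simp add: field_simps)
qed

section \<open>Summability and the boundary term at infinity\<close>

lemma summable_wz_bound: "summable (\<lambda>k. C * (1 / (real (Suc k))\<^sup>2))"
proof -
  have "summable (\<lambda>k. 1 / (real k)\<^sup>2)"
    using inverse_power_summable[of 2, where 'a = real] by (simp add: inverse_eq_divide)
  then show ?thesis
    by (intro summable_mult) (subst summable_Suc_iff)
qed

lemma abs_wz_weight_le: "\<bar>wz_weight m (real (Suc k))\<bar> \<le> 1 / (real (Suc k))\<^sup>2"
  using wz_weight_le[of "real (Suc k)" m] wz_weight_nonneg[of m "real (Suc k)"] by simp

lemma abs_wz_product_le:
  "\<bar>wz_weight m (real (Suc k)) * wz_slope m (real (Suc k))\<bar>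
    \<le> real (Suc m) * (1 / (real (Suc k))\<^sup>2)"
proof -
  have "\<bar>wz_weight m (real (Suc k))\<bar> * \<bar>wz_slope m (real (Suc k))\<bar>
      \<le> 1 / (real (Suc k))\<^sup>2 * real (Suc m)"
    by (intro mult_mono abs_wz_weight_le abs_wz_slope_le) simp_all
  then show ?thesis by (simp only: abs_mult mult.commute)
qed

lemma summable_wz_weight: "summable (\<lambda>k. wz_weight m (real (Suc k)))"
  by (rule summable_comparison_test'[OF summable_wz_bound[of 1], of 0])
    (simp only: real_norm_def mult_1_left abs_wz_weight_le)

lemma summable_wz_product:
  "summable (\<lambda>k. wz_weight m (real (Suc k)) * wz_slope m (real (Suc k)))"
  by (rule summable_comparison_test'[OF summable_wz_bound[of "real (Suc m)"], of 0])
    (simp only: real_norm_def abs_wz_product_le)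

text \<open>Makes the telescoping term \<open>g\<close> vanish at infinity: its multiplier is only
  linear in k.\<close>

lemma tendsto_zero_of_inverse_square_bound:
  fixes f :: "nat \<Rightarrow> real"
  assumes "\<And>k. \<bar>f k\<bar> \<le> C * (1 / (real (Suc k))\<^sup>2)"
  shows "(\<lambda>k. f k * (real (Suc k) + c)) \<longlonglongrightarrow> 0"
proof (rule Lim_null_comparison)
  show "\<forall>\<^sub>F k in sequentially. norm (f k * (real (Suc k) + c))
      \<le> C * (1 + \<bar>c\<bar>) * inverse (real (Suc k))"
  proof (rule always_eventually, rule allI)
    fix k
    define r where "r = real (Suc k)"
    have r: "r \<ge> 1" by (simp add: r_def)
    have C: "C \<ge> 0" using order_trans[OF abs_ge_zero assms[of 0]] by simp
    have "\<bar>c\<bar> * 1 \<le> \<bar>c\<bar> * r" using r by (intro mult_left_mono) simp_all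
    then have "\<bar>r + c\<bar> \<le> (1 + \<bar>c\<bar>) * r" using r by (simp add: algebra_simps)
    then have "\<bar>f k\<bar> * \<bar>r + c\<bar> \<le> (C * (1 / r\<^sup>2)) * ((1 + \<bar>c\<bar>) * r)"
      using assms[of k] C by (intro mult_mono) (simp_all add: r_def)
    also have "\<dots> = C * (1 + \<bar>c\<bar>) * inverse r"
      using r by (simp add: field_simps power2_eq_square)
    finally show "norm (f k * (real (Suc k) + c)) \<le> C * (1 + \<bar>c\<bar>) * inverse (real (Suc k))"
      by (simp only: real_norm_def abs_mult r_def)
  qed
  show "(\<lambda>k. C * (1 + \<bar>c\<bar>) * inverse (real (Suc k))) \<longlonglongrightarrow> 0"
    using tendsto_mult_left[OF LIMSEQ_inverse_real_of_nat, of "C * (1 + \<bar>c\<bar>)"] by simp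
qed

section \<open>The vectors v_m and their recurrences\<close>

text \<open>This is y_m of the overview. For n = m + 1 the factor 2m + 1 is the coefficient 2n - 1
  of the telescoping relations; at \<open>Suc m\<close> it is the 2n + 1 in the matrix
  denominators.\<close>

definition zeta2_tail :: "nat \<Rightarrow> real" where
  "zeta2_tail m = (2 * real m + 1) * (\<Sum>k. wz_weight m (real (Suc k)))"

definition zeta4_tail :: "nat \<Rightarrow> real" where
  "zeta4_tail m = (2 * real m + 1) * (\<Sum>k. wz_weight m (real (Suc k)) * wz_slope m (real (Suc k)))"

lemma zeta2_tail_0: "zeta2_tail 0 = riemann_zeta 2"
  by (simp add: zeta2_tail_def riemann_zeta_def)

lemma zeta4_tail_0: "zeta4_tail 0 = riemann_zeta 4"
  by (simp add: zeta4_tail_def riemann_zeta_def flip: power_add)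

text \<open>Second row of the vector relation: summing \<open>wz_weight_telescope\<close> over k >=
  1 leaves - g(1) = n^-2 * 3n/2.\<close>

lemma zeta2_tail_rec:
  fixes m :: nat
  defines "n \<equiv> real (Suc m)"
  shows "zeta2_tail m = n / (2 * (2 * n + 1)) * zeta2_tail (Suc m) + 3 / (2 * n)"
proof -
  define g where "g = (\<lambda>k. - wz_weight m k * (k + 3 * n / 2 - 1))"
  define w where "w = (\<lambda>m k. wz_weight m (real (Suc k)))"
  have n: "n > 0" by (simp add: n_def)
  have "(\<lambda>k. w m k * (real (Suc k) + (3 * n / 2 - 1))) \<longlonglongrightarrow> 0"
    unfolding w_def
    by (rule tendsto_zero_of_inverse_square_bound[where C = 1]) (use abs_wz_weight_le in simp)
  from tendsto_minus[OF this] have "(\<lambda>k. g (real (Suc k))) \<longlonglongrightarrow> 0"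
    by (simp add: g_def w_def algebra_simps)
  from telescope_sums[OF this]
  have "(\<lambda>k. g (real (Suc (Suc k))) - g (real (Suc k))) sums (- g 1)" by simp
  moreover have "g (real (Suc (Suc k))) - g (real (Suc k))
      = (2 * n - 1) * w m k - n / 2 * w (Suc m) k" for k
    using wz_weight_telescope[of "real (Suc k)" m]
    by (simp add: g_def w_def n_def add_ac del: wz_weight.simps)
  ultimately have "(\<lambda>k. (2 * n - 1) * w m k - n / 2 * w (Suc m) k) sums (- g 1)"
    by simp
  moreover have "(\<lambda>k. (2 * n - 1) * w m k - n / 2 * w (Suc m) k)
      sums ((2 * n - 1) * suminf (w m) - n / 2 * suminf (w (Suc m)))"
    unfolding w_def by (intro sums_diff sums_mult summable_sums summable_wz_weight)
  ultimately have "(2 * n - 1) * suminf (w m) - n / 2 * suminf (w (Suc m)) = - g 1"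
    by (rule sums_unique2[symmetric])
  moreover have "- g 1 = 3 / (2 * n)"
    using n unfolding g_def wz_weight_one n_def[symmetric]
    by (simp add: power2_eq_square)
  moreover have "zeta2_tail m = (2 * n - 1) * suminf (w m)"
    by (simp add: zeta2_tail_def w_def n_def)
  moreover have "n / (2 * (2 * n + 1)) * zeta2_tail (Suc m) = n / 2 * suminf (w (Suc m))"
    using n unfolding zeta2_tail_def w_def n_def[symmetric] by (simp add: divide_simps)
  ultimately show ?thesis by linarith
qed

text \<open>First row: the extra weight term of \<open>wz_slope_telescope\<close> sums to the
  \<open>zeta2_tail\<close> term, and - g(1) = n^-4 * 3n/2.\<close>

lemma zeta4_tail_rec:
  fixes m :: nat
  defines "n \<equiv> real (Suc m)"
  shows "zeta4_tail m = n / (2 * (2 * n + 1)) * zeta4_tail (Suc m)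
    + - 3 / (2 * n * (2 * n + 1)) * zeta2_tail (Suc m) + 3 / (2 * n ^ 3)"
proof -
  define g where "g = (\<lambda>k. - wz_weight m k * wz_slope m k * (k + 3 * n / 2 - 1))"
  define w where "w = (\<lambda>m k. wz_weight m (real (Suc k)))"
  define p where "p = (\<lambda>m k. wz_weight m (real (Suc k)) * wz_slope m (real (Suc k)))"
  have n: "n > 0" by (simp add: n_def)
  have "(\<lambda>k. p m k * (real (Suc k) + (3 * n / 2 - 1))) \<longlonglongrightarrow> 0"
    unfolding p_def by (rule tendsto_zero_of_inverse_square_bound[OF abs_wz_product_le])
  from tendsto_minus[OF this] have "(\<lambda>k. g (real (Suc k))) \<longlonglongrightarrow> 0"
    by (simp add: g_def p_def algebra_simps)
  from telescope_sums[OF this]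
  have "(\<lambda>k. g (real (Suc (Suc k))) - g (real (Suc k))) sums (- g 1)" by simp
  moreover have "g (real (Suc (Suc k))) - g (real (Suc k))
      = (2 * n - 1) * p m k - n / 2 * p (Suc m) k + 3 / (2 * n) * w (Suc m) k" for k
    using wz_slope_telescope[of "real (Suc k)" m]
    by (simp add: g_def p_def w_def n_def add_ac del: wz_weight.simps wz_slope.simps)
  ultimately have
    "(\<lambda>k. (2 * n - 1) * p m k - n / 2 * p (Suc m) k + 3 / (2 * n) * w (Suc m) k) sums (- g 1)"
    by simp
  moreover have "(\<lambda>k. (2 * n - 1) * p m k - n / 2 * p (Suc m) k + 3 / (2 * n) * w (Suc m) k)
      sums ((2 * n - 1) * suminf (p m) - n / 2 * suminf (p (Suc m))
        + 3 / (2 * n) * suminf (w (Suc m)))"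
    unfolding w_def p_def
    by (intro sums_add sums_diff sums_mult summable_sums summable_wz_weight summable_wz_product)
  ultimately have "(2 * n - 1) * suminf (p m) - n / 2 * suminf (p (Suc m))
      + 3 / (2 * n) * suminf (w (Suc m)) = - g 1"
    by (rule sums_unique2[symmetric])
  moreover have "- g 1 = 3 / (2 * n ^ 3)"
    using n unfolding g_def wz_weight_one wz_slope_one n_def[symmetric]
    by (simp add: power2_eq_square power3_eq_cube)
  moreover have "zeta4_tail m = (2 * n - 1) * suminf (p m)"
    by (simp add: zeta4_tail_def p_def n_def)
  moreover have "n / (2 * (2 * n + 1)) * zeta4_tail (Suc m) = n / 2 * suminf (p (Suc m))"
    using n unfolding zeta4_tail_def p_def n_def[symmetric] by (simp add: divide_simps)
  moreover have "- 3 / (2 * n * (2 * n + 1)) * zeta2_tail (Suc m)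
      = - (3 / (2 * n) * suminf (w (Suc m)))"
    using n unfolding zeta2_tail_def w_def n_def[symmetric] by (simp add: divide_simps)
  ultimately show ?thesis by linarith
qed

section \<open>Polynomial bounds for the tails\<close>

definition inverse_square_sum :: real where
  "inverse_square_sum = (\<Sum>k. 1 / (real (Suc k))\<^sup>2)"

lemma abs_suminf_le_inverse_square_sum:
  fixes f :: "nat \<Rightarrow> real"
  assumes "\<And>k. \<bar>f k\<bar> \<le> C * (1 / (real (Suc k))\<^sup>2)"
  shows "\<bar>suminf f\<bar> \<le> C * inverse_square_sum"
proof -
  have "norm (suminf f) \<le> (\<Sum>k. C * (1 / (real (Suc k))\<^sup>2))"
    by (rule norm_suminf_le[OF _ summable_wz_bound]) (use assms in \<open>simp only: real_norm_def\<close>)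
  also have "\<dots> = C * inverse_square_sum"
    unfolding inverse_square_sum_def
    using summable_wz_bound[of 1] by (intro suminf_mult) (simp del: of_nat_Suc)
  finally show ?thesis by simp
qed

lemma abs_zeta2_tail_le: "\<bar>zeta2_tail m\<bar> \<le> (2 * real m + 1) * inverse_square_sum"
proof -
  have "\<bar>\<Sum>k. wz_weight m (real (Suc k))\<bar> \<le> 1 * inverse_square_sum"
    by (rule abs_suminf_le_inverse_square_sum) (simp only: mult_1_left abs_wz_weight_le)
  then show ?thesis
    unfolding zeta2_tail_def abs_mult by (intro mult_mono) simp_all
qed

lemma abs_zeta4_tail_le:
  "\<bar>zeta4_tail m\<bar> \<le> (2 * real m + 1) * (real (Suc m) * inverse_square_sum)"
  unfolding zeta4_tail_def abs_mult
  by (intro mult_mono abs_suminf_le_inverse_square_sum abs_wz_product_le) simp_all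

section \<open>Geometric decay of the first two columns\<close>

text \<open>\<open>prod_diag\<close> is the common (1,1) and (2,2) entry of the partial product,
  \<open>prod_off\<close> the (1,2) entry.\<close>

primrec prod_diag :: "nat \<Rightarrow> real" where
  "prod_diag 0 = 1"
| "prod_diag (Suc m) = prod_diag m * (real (Suc m) / (2 * (2 * real (Suc m) + 1)))"

primrec prod_off :: "nat \<Rightarrow> real" where
  "prod_off 0 = 0"
| "prod_off (Suc m) = prod_diag m * (- 3 / (2 * real (Suc m) * (2 * real (Suc m) + 1)))
    + prod_off m * (real (Suc m) / (2 * (2 * real (Suc m) + 1)))"

lemma abs_prod_diag_le: "\<bar>prod_diag m\<bar> \<le> (1 / 4) ^ m"
proof (induction m)
  case (Suc m)
  have "\<bar>real (Suc m) / (2 * (2 * real (Suc m) + 1))\<bar> \<le> 1 / 4"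
    by (simp add: divide_simps)
  with Suc have "\<bar>prod_diag m\<bar> * \<bar>real (Suc m) / (2 * (2 * real (Suc m) + 1))\<bar>
      \<le> (1 / 4) ^ m * (1 / 4)"
    by (intro mult_mono) simp_all
  then show ?case by (simp only: prod_diag.simps abs_mult power_Suc2)
qed simp

text \<open>The entry is a sum of m products, each with one off-diagonal factor, at most 1/2 = 2 *
  (1/4) in modulus, and m - 1 diagonal factors, at most 1/4.\<close>

lemma abs_prod_off_le: "\<bar>prod_off m\<bar> \<le> 2 * real m * (1 / 4) ^ m"
proof (induction m)
  case (Suc m)
  define n where "n = real (Suc m)"
  have n: "n \<ge> 1" by (simp add: n_def)
  have "1 * 1 \<le> n * n" using n by (intro mult_mono) simp_all
  then have "\<bar>- 3 / (2 * n * (2 * n + 1))\<bar> \<le> 1 / 2"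
    using n by (simp add: abs_mult) (simp add: field_simps)
  then have 1: "\<bar>prod_diag m * (- 3 / (2 * n * (2 * n + 1)))\<bar> \<le> (1 / 4) ^ m * (1 / 2)"
    unfolding abs_mult by (intro mult_mono abs_prod_diag_le) simp_all
  have "\<bar>n / (2 * (2 * n + 1))\<bar> \<le> 1 / 4"
    using n by (simp add: divide_simps)
  then have 2: "\<bar>prod_off m * (n / (2 * (2 * n + 1)))\<bar> \<le> 2 * real m * (1 / 4) ^ m * (1 / 4)"
    unfolding abs_mult by (intro mult_mono Suc.IH) simp_all
  have "\<bar>prod_off (Suc m)\<bar> \<le> (1 / 4) ^ m * (1 / 2) + 2 * real m * (1 / 4) ^ m * (1 / 4)"
    unfolding prod_off.simps n_def[symmetric] using abs_triangle_ineq 1 2 by (meson add_mono order_trans)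
  also have "\<dots> = 2 * real (Suc m) * (1 / 4) ^ Suc m"
    by (simp add: field_simps)
  finally show ?case .
qed simp

section \<open>Closed form of the partial products and the limit\<close>

abbreviation (input) mat3 :: "real \<Rightarrow> real \<Rightarrow> real \<Rightarrow> real \<Rightarrow> real ^ 3 ^ 3" where
  "mat3 a b x y \<equiv> vector [vector [a, b, x], vector [0, a, y], vector [0, 0, 1]]"

lemma mat3_mult: "mat3 a b x y ** mat3 a' b' x' y'
    = mat3 (a * a') (a * b' + b * a') (a * x' + b * y' + x) (a * y' + y)"
  by (simp add: vec_eq_iff forall_3 matrix_matrix_mult_def sum_3)

lemma mat3_one: "(mat 1 :: real ^ 3 ^ 3) = mat3 1 0 0 0"
  by (simp add: vec_eq_iff forall_3 mat_def)

text \<open>The last column is the invariant M_1 ... M_m v_m = v_0 solved for that column.\<close>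

lemma matrix_partial_prod_eq:
  "matrix_partial_prod (\<lambda>n. mat3 (real n / (2 * (2 * real n + 1)))
      (- 3 / (2 * real n * (2 * real n + 1))) (3 / (2 * real n ^ 3)) (3 / (2 * real n))) m
   = mat3 (prod_diag m) (prod_off m)
      (riemann_zeta 4 - prod_diag m * zeta4_tail m - prod_off m * zeta2_tail m)
      (riemann_zeta 2 - prod_diag m * zeta2_tail m)"
proof (induction m)
  case 0
  then show ?case by (simp add: mat3_one zeta2_tail_0 zeta4_tail_0)
next
  case (Suc m)
  define n where "n = real (Suc m)"
  define a where "a = n / (2 * (2 * n + 1))"
  define b where "b = - 3 / (2 * n * (2 * n + 1))"
  \<comment> \<open>Rewriting the tails at \<open>m\<close> through those at \<open>Suc m\<close>
    leaves a ring identity with \<open>a\<close> and \<open>b\<close> as atoms.\<close>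
  show ?case
    unfolding matrix_partial_prod.simps Suc.IH mat3_mult prod_diag.simps prod_off.simps
      zeta2_tail_rec[of m] zeta4_tail_rec[of m] n_def[symmetric] a_def[symmetric] b_def[symmetric]
    by (simp add: algebra_simps)
qed

theorem theorem6p2:
  "has_matrix_prod
     (\<lambda>n. vector
        [vector [real n / (2 * (2 * real n + 1)), - 3 / (2 * real n * (2 * real n + 1)), 3 / (2 * real n ^ 3)],
         vector [0, real n / (2 * (2 * real n + 1)), 3 / (2 * real n)],
         vector [0, 0, 1]] :: real ^ 3 ^ 3)
     (vector
        [vector [0, 0, riemann_zeta 4],
         vector [0, 0, riemann_zeta 2],
         vector [0, 0, 1]])"
proof -
  define S where "S = inverse_square_sum"
  have diag: "prod_diag \<longlonglongrightarrow> 0"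
    by (rule Lim_null_comparison[of _ "\<lambda>m. (1 / 4) ^ m"])
      (use abs_prod_diag_le in \<open>auto intro: LIMSEQ_realpow_zero\<close>)
  have off: "prod_off \<longlonglongrightarrow> 0"
  proof (rule Lim_null_comparison)
    show "\<forall>\<^sub>F m in sequentially. norm (prod_off m) \<le> 2 * real m * (1 / 4) ^ m"
      using abs_prod_off_le by simp
    show "(\<lambda>m. 2 * real m * (1 / 4) ^ m) \<longlonglongrightarrow> 0" by real_asymp
  qed
  \<comment> \<open>The bounds on the tails grow with m, so the geometric rates of
    \<open>prod_diag\<close> and \<open>prod_off\<close> are used here, not just their
    limits.\<close>
  have diag2: "(\<lambda>m. prod_diag m * zeta2_tail m) \<longlonglongrightarrow> 0"
  proof (rule Lim_null_comparison)
    show "\<forall>\<^sub>F m in sequentially. norm (prod_diag m * zeta2_tail m)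
        \<le> (1 / 4) ^ m * ((2 * real m + 1) * S)"
      unfolding real_norm_def abs_mult S_def
      by (intro always_eventually allI mult_mono abs_prod_diag_le abs_zeta2_tail_le) simp_all
    show "(\<lambda>m. (1 / 4) ^ m * ((2 * real m + 1) * S)) \<longlonglongrightarrow> 0" by real_asymp
  qed
  have diag4: "(\<lambda>m. prod_diag m * zeta4_tail m) \<longlonglongrightarrow> 0"
  proof (rule Lim_null_comparison)
    show "\<forall>\<^sub>F m in sequentially. norm (prod_diag m * zeta4_tail m)
        \<le> (1 / 4) ^ m * ((2 * real m + 1) * (real (Suc m) * S))"
      unfolding real_norm_def abs_mult S_def
      by (intro always_eventually allI mult_mono abs_prod_diag_le abs_zeta4_tail_le) simp_all
    show "(\<lambda>m. (1 / 4) ^ m * ((2 * real m + 1) * (real (Suc m) * S))) \<longlonglongrightarrow> 0" by real_asymp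
  qed
  have off2: "(\<lambda>m. prod_off m * zeta2_tail m) \<longlonglongrightarrow> 0"
  proof (rule Lim_null_comparison)
    show "\<forall>\<^sub>F m in sequentially. norm (prod_off m * zeta2_tail m)
        \<le> 2 * real m * (1 / 4) ^ m * ((2 * real m + 1) * S)"
      unfolding real_norm_def abs_mult S_def
      by (intro always_eventually allI mult_mono abs_prod_off_le abs_zeta2_tail_le) simp_all
    show "(\<lambda>m. 2 * real m * (1 / 4) ^ m * ((2 * real m + 1) * S)) \<longlonglongrightarrow> 0" by real_asymp
  qed
  have "(\<lambda>m. riemann_zeta 4 - prod_diag m * zeta4_tail m - prod_off m * zeta2_tail m)
      \<longlonglongrightarrow> riemann_zeta 4"
    using tendsto_diff[OF tendsto_diff[OF tendsto_const diag4] off2] by simp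
  moreover have "(\<lambda>m. riemann_zeta 2 - prod_diag m * zeta2_tail m) \<longlonglongrightarrow> riemann_zeta 2"
    using tendsto_diff[OF tendsto_const diag2] by simp
  ultimately show ?thesis
    unfolding has_matrix_prod_def matrix_partial_prod_eq
    using diag off by (simp add: forall_3)
qed

end
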